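(* Let $p$ be an odd prime, let $q\in\mathbb{C}_p$ with $q\neq 1$ and $|1-q|_p<p^{-\frac{1}{p-1}}$, let $\lambda\in\mathbb{C}_p$, $r\in\mathbb{N}$, $x\in\mathbb{Z}_p$, $n\ge 0$ and $w_1,w_2\in\mathbb{N}$. Then \begin{align*} &[w_1]_q^{n-r} \sum_{j_1,\dots,j_r=0}^{w_1-1} q^{w_2 \sum_{l=1}^r j_l}\, \beta_{n,\frac{\lambda}{[w_1]_q},q^{w_1}}^{(r)}\Big( w_2x + \frac{w_2}{w_1} \sum_{l=1}^r j_l \Big)\\ &=[w_2]_q^{n-r} \sum_{j_1,\dots,j_r=0}^{w_2-1} q^{w_1 \sum_{l=1}^r j_l}\, \beta_{n,\frac{\lambda}{[w_2]_q},q^{w_2}}^{(r)}\Big( w_1x + \frac{w_1}{w_2} \sum_{l=1}^r j_l \Big). \end{align*}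
   Context: $\mathbb{Z}_p,\mathbb{C}_p$ are the $p$-adic integers and the completion of the algebraic closure of $\mathbb{Q}_p$, $|p|_p=1/p$. For $w\in\mathbb{N}$ and $z\in\mathbb{Q}_p$ with $wz\in\mathbb{Z}_p$, set $[z]_{q^w}=\frac{1-q^{wz}}{1-q^w}$ (so $[z]_q=\frac{1-q^z}{1-q}$ for $z\in\mathbb{Z}_p$). For $a\in\mathbb{C}_p$ and $\mu\in\mathbb{C}_p$, $(a)_{0,\mu}=1$, $(a)_{n,\mu}=a(a-\mu)\cdots(a-(n-1)\mu)$. The $p$-adic $q^w$-integral of a uniformly differentiable $f$ on $\mathbb{Z}_p$ is $\int_{\mathbb{Z}_p}f(y)\,d\mu_{q^w}(y)=\lim_{N\to\infty}\frac{1}{[p^N]_{q^w}}\sum_{y=0}^{p^N-1}f(y)q^{wy}$, and multiple integrals are iterated. The higher-order degenerate $q$-Bernoulli polynomials are, for $w\in\mathbb{N}$, $\mu\in\mathbb{C}_p$ and $z$ with $wz\in\mathbb{Z}_p$, $$\beta^{(r)}_{n,\mu,q^w}(z)=\int_{\mathbb{Z}_p}\cdots\int_{\mathbb{Z}_p}\big([y_1+\cdots+y_r+z]_{q^w}\big)_{n,\mu}\,d\mu_{q^w}(y_1)\cdots d\mu_{q^w}(y_r),$$ equivalently $\sum_{n\ge0}\beta^{(r)}_{n,\mu,q^w}(z)\frac{t^n}{n!}=\int\cdots\int(1+\mu t)^{\frac1\mu[y_1+\cdots+y_r+z]_{q^w}}d\mu_{q^w}(y_1)\cdots d\mu_{q^w}(y_r)$.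 *)

theory Defs
  imports "HOL-Analysis.Analysis" "HOL-Computational_Algebra.Computational_Algebra"
begin

text \<open>
  Fields of characteristic zero with a non-archimedean absolute value, carrying the induced
  metric topology.  The class \<^class>\<open>real_normed_field\<close> is not applicable to p-adic fields,
  which are not normed real vector spaces; its operation \<^const>\<open>norm\<close> is tied to such
  spaces, hence the separate operation \<open>absval\<close>.
\<close>

class nonarch_field = field_char_0 + metric_space +
  fixes absval :: "'a \<Rightarrow> real"
  assumes dist_absval: "dist x y = absval (x - y)"
    and absval_mult: "absval (x * y) = absval x * absval y"
    and absval_add_le: "absval (x + y) \<le> max (absval x) (absval y)"

lemma absval_nonneg: "0 \<le> absval (x :: 'a::nonarch_field)"
  by (metis diff_zero dist_absval zero_le_dist)

lemma absval_eq_0_iff: "absval x = 0 \<longleftrightarrow> x = (0 :: 'a::nonarch_field)"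
  by (metis diff_zero dist_absval dist_eq_0_iff)

text \<open>
  In a complete field whose absolute value satisfies \<open>absval p = 1/p\<close> (which forces it to
  be the p-adic one on \<open>\<rat>\<close>), the completion of \<open>\<rat>\<close> is the closure of \<open>\<rat>\<close>.
\<close>

definition padic_rats :: "'a::nonarch_field set" where
  "padic_rats = closure \<rat>"

definition padic_ints :: "'a::nonarch_field set" where
  "padic_ints = {z \<in> padic_rats. absval z \<le> 1}"

definition padic_algebraic :: "'a::nonarch_field set" where
  "padic_algebraic =
     {a. \<exists>f. f \<noteq> 0 \<and> (\<forall>i. coeff f i \<in> padic_rats) \<and> poly f a = 0}"

text \<open>
  The type \<open>'a\<close> is (a model of) the field of p-adic complex numbers: it is complete, and the
  algebraic elements over \<open>padic_rats\<close> form an algebraically closed (hence an algebraic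
  closure of \<open>padic_rats\<close>) dense subset.  This determines the valued field \<open>'a\<close> up to isometric
  isomorphism.
\<close>

definition is_padic_complex :: "nat \<Rightarrow> 'a::nonarch_field itself \<Rightarrow> bool" where
  "is_padic_complex p T \<longleftrightarrow>
     absval (of_nat p :: 'a) = 1 / real p \<and>
     complete (UNIV :: 'a set) \<and>
     closure (padic_algebraic :: 'a set) = UNIV \<and>
     (\<forall>f :: 'a poly. degree f > 0 \<and> (\<forall>i. coeff f i \<in> padic_algebraic) \<longrightarrow>
        (\<exists>a \<in> padic_algebraic. poly f a = 0))"

text \<open>
  The power \<open>q\<^sup>z\<close> with a p-adic integer exponent, as the continuous extension of \<open>n \<mapsto> q ^ n\<close>
  from the natural numbers: the limit of \<open>q ^ n\<close> as the natural number \<open>n\<close> tends to \<open>z\<close>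
  p-adically.  It exists for \<open>absval (1 - q) < 1\<close>, and agrees with \<open>exp (z * log q)\<close>
  whenever \<open>absval (1 - q) < p powr (- 1 / (p - 1))\<close>.
\<close>

definition padic_pow :: "'a::nonarch_field \<Rightarrow> 'a \<Rightarrow> 'a" where
  "padic_pow q z = Lim (filtercomap of_nat (nhds z)) (\<lambda>n. q ^ n)"

text \<open>
  \<open>qbracket q w z\<close> is \<open>[z]\<close> to the base \<open>q ^ w\<close>.  Here \<open>z\<close> need not be a p-adic integer, only
  \<open>w * z\<close>, so \<open>q\<close> and \<open>w\<close> are separate arguments.
\<close>

definition qbracket :: "'a::nonarch_field \<Rightarrow> nat \<Rightarrow> 'a \<Rightarrow> 'a" where
  "qbracket q w z = (1 - padic_pow q (of_nat w * z)) / (1 - q ^ w)"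

definition degenerate_ffact :: "'a::comm_ring_1 \<Rightarrow> nat \<Rightarrow> 'a \<Rightarrow> 'a" where
  "degenerate_ffact a n \<mu> = (\<Prod>i<n. a - of_nat i * \<mu>)"

text \<open>The integral over the p-adic integers with respect to the base \<open>q ^ w\<close>.\<close>

definition q_integral :: "nat \<Rightarrow> 'a::nonarch_field \<Rightarrow> nat \<Rightarrow> ('a \<Rightarrow> 'a) \<Rightarrow> 'a" where
  "q_integral p q w f =
     lim (\<lambda>N. 1 / qbracket q w (of_nat (p ^ N)) * (\<Sum>y<p ^ N. f (of_nat y) * q ^ (w * y)))"

text \<open>
  The iterated integral of a function of \<open>[y\<^sub>1, \<dots>, y\<^sub>r]\<close>, with \<open>y\<^sub>1\<close> innermost.
\<close>

primrec q_integral_iter ::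
  "nat \<Rightarrow> 'a::nonarch_field \<Rightarrow> nat \<Rightarrow> nat \<Rightarrow> ('a list \<Rightarrow> 'a) \<Rightarrow> 'a" where
  "q_integral_iter p q w 0 f = f []"
| "q_integral_iter p q w (Suc r) f =
     q_integral p q w (\<lambda>y. q_integral_iter p q w r (\<lambda>ys. f (ys @ [y])))"

text \<open>\<open>degenerate_q_bernoulli p r n \<mu> q w z\<close> is \<open>\<beta>\<close> of order \<open>r\<close> with indices \<open>n\<close>, \<open>\<mu>\<close>, \<open>q ^ w\<close>.\<close>

definition degenerate_q_bernoulli ::
  "nat \<Rightarrow> nat \<Rightarrow> nat \<Rightarrow> 'a::nonarch_field \<Rightarrow> 'a \<Rightarrow> nat \<Rightarrow> 'a \<Rightarrow> 'a" where
  "degenerate_q_bernoulli p r n \<mu> q w z =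
     q_integral_iter p q w r (\<lambda>ys. degenerate_ffact (qbracket q w (sum_list ys + z)) n \<mu>)"

end

theory Submission
  imports Defs "HOL-Number_Theory.Cong"
begin

text \<open>
  Close to 1, \<open>q\<close> satisfies \<open>|q ^ k - 1| = |q - 1| |k|\<close>.  Hence \<open>q\<close> is not a root of unity and
  \<open>n \<mapsto> q ^ n\<close> is Lipschitz, so that \<open>q\<close> to a p-adic power exists and is multiplicative.
  The integral of \<open>q ^ (w i y)\<close> to the base \<open>q ^ w\<close> is a limit of quotients of geometric sums,
  namely \<open>(i + 1) (1 - q ^ w) / (1 - q ^ (w (i + 1)))\<close>.  Pulling \<open>[w\<^sub>1]\<close> into the degenerate
  factorial turns the integrand into a polynomial in a power of \<open>q\<close> whose coefficients involve
  neither \<open>w\<^sub>1\<close> nor \<open>w\<^sub>2\<close>; integrating its monomials and summing over \<open>j\<close> gives an expression that is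
  visibly symmetric in \<open>w\<^sub>1\<close> and \<open>w\<^sub>2\<close>.
\<close>

section \<open>Fields with a non-archimedean absolute value\<close>

lemma absval_0 [simp]: "absval (0 :: 'a::nonarch_field) = 0"
  by (simp add: absval_eq_0_iff)

lemma absval_1 [simp]: "absval (1 :: 'a::nonarch_field) = 1"
proof -
  have "absval (1::'a) * absval (1::'a) = absval (1::'a)"
    by (simp flip: absval_mult)
  moreover have "absval (1::'a) \<noteq> 0"
    by (simp add: absval_eq_0_iff)
  ultimately show ?thesis by simp
qed

lemma absval_minus [simp]: "absval (- x) = absval (x :: 'a::nonarch_field)"
  using dist_commute[of x 0] by (simp add: dist_absval)

lemma absval_minus_commute: "absval (x - y) = absval (y - x :: 'a::nonarch_field)"
  using absval_minus[of "x - y"] by simp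

lemma absval_add_le_bound:
  assumes "absval x \<le> B" "absval y \<le> B"
  shows "absval (x + y :: 'a::nonarch_field) \<le> B"
  using absval_add_le[of x y] assms by linarith

lemma absval_add_less_bound:
  assumes "absval x < B" "absval y < B"
  shows "absval (x + y :: 'a::nonarch_field) < B"
  using absval_add_le[of x y] assms by linarith

lemma absval_power: "absval (x ^ n) = absval (x :: 'a::nonarch_field) ^ n"
  by (induction n) (simp_all add: absval_mult)

lemma absval_divide: "absval (x / y) = absval x / absval (y :: 'a::nonarch_field)"
proof (cases "y = 0")
  case False
  then have "absval (x / y) * absval y = absval x" by (simp flip: absval_mult)
  with False show ?thesis by (simp add: field_simps absval_eq_0_iff)
qed simp

lemma absval_of_nat_le_1: "absval (of_nat n :: 'a::nonarch_field) \<le> 1"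
proof (induction n)
  case (Suc n)
  then show ?case using absval_add_le[of "1::'a" "of_nat n"] by simp
qed simp

lemma absval_of_int_le_1: "absval (of_int n :: 'a::nonarch_field) \<le> 1"
  by (cases n) (simp_all add: absval_of_nat_le_1 del: of_nat_Suc)

lemma absval_sum_le:
  fixes f :: "'b \<Rightarrow> 'a::nonarch_field"
  assumes "\<And>i. i \<in> A \<Longrightarrow> absval (f i) \<le> B" "0 \<le> B"
  shows "absval (sum f A) \<le> B"
  using assms
proof (induction A rule: infinite_finite_induct)
  case (insert i A)
  then show ?case by (simp add: absval_add_le_bound)
qed auto

lemma absval_sum_less:
  fixes f :: "'b \<Rightarrow> 'a::nonarch_field"
  assumes "\<And>i. i \<in> A \<Longrightarrow> absval (f i) < B" "0 < B"
  shows "absval (sum f A) < B"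
  using assms
proof (induction A rule: infinite_finite_induct)
  case (insert i A)
  then show ?case by (simp add: absval_add_less_bound)
qed auto

text \<open>Since \<open>x = (x + y) - y\<close>, the ultrametric inequality bounds
  \<open>absval x\<close> by \<open>absval (x + y)\<close> or by \<open>absval y\<close>, and the
  latter is too small.\<close>

lemma absval_add_eq:
  fixes x y :: "'a::nonarch_field"
  assumes "absval y < absval x"
  shows "absval (x + y) = absval x"
  using assms absval_add_le[of x y] absval_add_le[of "x + y" "- y"] by auto

text \<open>The cofactor of \<open>q - 1\<close> in \<open>q ^ n - 1\<close> is a geometric sum of
  elements of absolute value at most 1.\<close>

lemma absval_power_diff_1_le:
  fixes q :: "'a::nonarch_field"
  assumes "absval q \<le> 1"
  shows "absval (q ^ n - 1) \<le> absval (q - 1)"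
proof -
  have "absval (\<Sum>i<n. q ^ i) \<le> 1"
    using assms by (intro absval_sum_le) (simp_all add: absval_power power_le_one absval_nonneg)
  then show ?thesis
    by (simp add: power_diff_1_eq absval_mult mult_left_le absval_nonneg)
qed

text \<open>Continuity of addition makes the library rules \<open>tendsto_add\<close> and
  \<open>tendsto_sum\<close> available for limits in the field.\<close>

instance nonarch_field \<subseteq> topological_comm_monoid_add
proof
  fix a b :: 'a
  show "((\<lambda>x. fst x + snd x) \<longlongrightarrow> a + b) (nhds a \<times>\<^sub>F nhds b)"
  proof (rule tendstoI)
    fix e :: real
    assume "e > 0"
    then have "eventually (\<lambda>x. dist x a < e) (nhds a)" "eventually (\<lambda>x. dist x b < e) (nhds b)"
      by (auto simp: eventually_nhds_metric)
    then have "eventually (\<lambda>x. dist (fst x) a < e \<and> dist (snd x) b < e) (nhds a \<times>\<^sub>F nhds b)"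
      unfolding eventually_prod_filter by (force intro!: exI)
    then show "eventually (\<lambda>x. dist (fst x + snd x) (a + b) < e) (nhds a \<times>\<^sub>F nhds b)"
    proof eventually_elim
      case (elim x)
      then show ?case
        using absval_add_less_bound[of "fst x - a" e "snd x - b"]
        by (simp add: dist_absval algebra_simps)
    qed
  qed
qed

lemma tendsto_absval_iff:
  fixes f :: "'b \<Rightarrow> 'a::nonarch_field"
  shows "(f \<longlongrightarrow> l) F \<longleftrightarrow> ((\<lambda>x. absval (f x - l)) \<longlongrightarrow> 0) F"
  using tendsto_dist_iff[of f l F] by (simp add: dist_absval)

lemma tendsto_mult_left_nonarch:
  fixes f :: "'b \<Rightarrow> 'a::nonarch_field"
  assumes "(f \<longlongrightarrow> l) F"
  shows "((\<lambda>x. c * f x) \<longlongrightarrow> c * l) F"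
  using tendsto_mult_left[OF assms[unfolded tendsto_absval_iff], of "absval c"]
  unfolding tendsto_absval_iff by (simp flip: right_diff_distrib add: absval_mult)

section \<open>Powers of elements close to 1\<close>

locale padic_field =
  fixes p :: nat and T :: "'a::nonarch_field itself"
  assumes prime_p: "prime p"
    and absval_p: "absval (of_nat p :: 'a) = 1 / real p"
    and complete_UNIV: "complete (UNIV :: 'a set)"
begin

text \<open>In a Bezout relation \<open>a * m + b * p = 1\<close>, \<open>absval m < 1\<close> would
  make both terms smaller than 1, against \<open>absval 1 = 1\<close>.\<close>

lemma absval_of_nat_coprime:
  assumes "\<not> p dvd m"
  shows "absval (of_nat m :: 'a) = 1"
proof (rule antisym[OF absval_of_nat_le_1], rule ccontr)
  assume *: "\<not> 1 \<le> absval (of_nat m :: 'a)"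
  have "coprime (int m) (int p)"
    using assms prime_imp_coprime[OF prime_p] by (simp add: coprime_commute[of m])
  then obtain a b where "a * int m + b * int p = 1"
    using bezout_int[of "int m" "int p"] by (auto simp: coprime_iff_gcd_eq_1)
  then have "of_int (a * int m + b * int p) = (1::'a)" by simp
  then have "(of_int a * of_nat m + of_int b * of_nat p :: 'a) = 1" by simp
  moreover have "absval (of_int c * of_nat k :: 'a) < 1" if "absval (of_nat k :: 'a) < 1" for c k
  proof -
    have "absval (of_int c :: 'a) * absval (of_nat k :: 'a) \<le> absval (of_nat k :: 'a)"
      by (intro mult_left_le_one_le absval_nonneg absval_of_int_le_1)
    with that show ?thesis by (simp add: absval_mult)
  qed
  moreover have "absval (of_nat p :: 'a) < 1"
    using prime_gt_1_nat[OF prime_p] by (simp add: absval_p)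
  ultimately show False
    using * absval_add_le[of "of_int a * of_nat m :: 'a" "of_int b * of_nat p"]
    by (smt (verit) absval_1)
qed

text \<open>The assumption is the bound p^(-1/(p-1)) on \<open>absval u\<close>, raised to the power
  \<open>p - 1\<close> so that no real exponents occur.\<close>

lemma absval_less_1:
  assumes "absval (u :: 'a) ^ (p - 1) < 1 / real p"
  shows "absval u < 1"
proof (rule ccontr)
  assume "\<not> absval u < 1"
  then have "1 \<le> absval u ^ (p - 1)" by (simp add: one_le_power)
  moreover have "1 / real p < 1" using prime_gt_1_nat[OF prime_p] by simp
  ultimately show False using assms by simp
qed

text \<open>The binomial expansion of \<open>(1 + u) ^ p - 1\<close> is dominated by its term \<open>p * u\<close>.\<close>

lemma absval_power_p_diff_1:
  fixes q :: 'a
  assumes "absval (q - 1) ^ (p - 1) < 1 / real p"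
  shows "absval (q ^ p - 1) = absval (q - 1) * absval (of_nat p :: 'a)"
proof (cases "q = 1")
  case False
  define u where "u = q - 1"
  have p: "p \<ge> 2" using prime_p prime_ge_2_nat by blast
  have u0: "absval u > 0"
    using False absval_nonneg[of u] absval_eq_0_iff[of u] by (simp add: u_def)
  have u1: "absval u < 1"
    unfolding u_def by (rule absval_less_1[OF assms])
  have "q ^ p = (u + 1) ^ p" by (simp add: u_def)
  also have "\<dots> = (\<Sum>k\<le>p. of_nat (p choose k) * u ^ k)"
    by (simp add: binomial_ring)
  also have "{..p} = insert 0 (insert 1 {2..p})" using p by auto
  also have "(\<Sum>k\<in>\<dots>. of_nat (p choose k) * u ^ k)
      = 1 + (of_nat p * u + (\<Sum>k=2..p. of_nat (p choose k) * u ^ k))"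
    by simp
  finally have q: "q ^ p - 1 = of_nat p * u + (\<Sum>k=2..p. of_nat (p choose k) * u ^ k)" by simp
  have "absval (\<Sum>k=2..p. of_nat (p choose k) * u ^ k) < absval (of_nat p * u)"
  proof (rule absval_sum_less)
    fix k assume k: "k \<in> {2..p}"
    show "absval (of_nat (p choose k) * u ^ k) < absval (of_nat p * u)"
    proof (cases "k = p")
      case True
      \<comment> \<open>The last term \<open>u ^ p\<close> has no factor \<open>p\<close>; the
        closeness assumption on \<open>q\<close> is exactly what makes it smaller than
        \<open>p * u\<close>.\<close>
      have "absval u ^ p = absval u ^ (p - 1) * absval u"
        using p by (simp flip: power_Suc2)
      also have "\<dots> < 1 / real p * absval u"
        using assms u0 by (intro mult_strict_right_mono) (simp_all add: u_def)
      finally show ?thesis using True by (simp add: absval_mult absval_power absval_p)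
    next
      case False
      \<comment> \<open>The middle coefficients are divisible by \<open>p\<close>, and
        \<open>k \<ge> 2\<close> makes \<open>u ^ k\<close> strictly smaller than
        \<open>u\<close>.\<close>
      then have "p dvd p choose k" using k prime_p by (intro dvd_choose_prime) auto
      then obtain c where c: "p choose k = p * c" by blast
      have "absval (of_nat c * u ^ k) \<le> absval u ^ k"
        using mult_left_le_one_le[OF _ absval_nonneg absval_of_nat_le_1, of "absval u ^ k" c]
        by (simp add: absval_mult absval_power absval_nonneg)
      also have "\<dots> < absval u"
        using power_strict_decreasing[of 1 k "absval u"] k u0 u1 by simp
      finally have "absval (of_nat p :: 'a) * absval (of_nat c * u ^ k) < absval (of_nat p :: 'a) * absval u"
        using p by (intro mult_strict_left_mono) (simp_all add: absval_p)
      then show ?thesis by (simp add: c mult.assoc flip: absval_mult)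
    qed
  next
    show "0 < absval (of_nat p * u)" using u0 p by (simp add: absval_mult absval_p)
  qed
  then have "absval (q ^ p - 1) = absval (of_nat p * u)"
    unfolding q by (rule absval_add_eq)
  then show ?thesis by (simp add: absval_mult u_def mult.commute)
qed simp

text \<open>Each factor \<open>p\<close> of \<open>k\<close> is removed by passing from
  \<open>q\<close> to \<open>q ^ p\<close>, which is why the induction generalizes over
  \<open>q\<close>. Once \<open>k\<close> is prime to \<open>p\<close>, the cofactor of
  \<open>q - 1\<close> has absolute value 1.\<close>

lemma absval_power_diff_1:
  fixes q :: 'a
  assumes "absval (q - 1) ^ (p - 1) < 1 / real p"
  shows "absval (q ^ k - 1) = absval (q - 1) * absval (of_nat k :: 'a)"
  using assms
proof (induction k arbitrary: q rule: less_induct)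
  case (less k)
  have p: "p \<ge> 2" using prime_p prime_ge_2_nat by blast
  have u1: "absval (q - 1) < 1"
    by (rule absval_less_1[OF less.prems])
  have q1: "absval q \<le> 1"
    using absval_add_le[of "q - 1" 1] u1 by simp
  consider "k = 0" | "\<not> p dvd k" | k' where "k = p * k'" "k > 0" by blast
  then show ?case
  proof cases
    case 2
    \<comment> \<open>The geometric sum differs from \<open>k\<close> by an element smaller than 1,
      so it inherits the absolute value 1 of \<open>k\<close>.\<close>
    have "absval (\<Sum>i<k. q ^ i - 1) < 1"
      using absval_power_diff_1_le[OF q1] u1 by (intro absval_sum_less) (auto intro: le_less_trans)
    then have "absval (of_nat k + (\<Sum>i<k. q ^ i - 1)) = 1"
      using absval_add_eq[of "\<Sum>i<k. q ^ i - 1" "of_nat k"] absval_of_nat_coprime[OF 2] by simp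
    also have "of_nat k + (\<Sum>i<k. q ^ i - 1) = (\<Sum>i<k. q ^ i)"
      by (simp add: sum_subtractf del: power_diff_1_eq)
    finally show ?thesis
      using absval_of_nat_coprime[OF 2] by (simp add: power_diff_1_eq absval_mult)
  next
    case 3
    then have "k' < k" using p by simp
    \<comment> \<open>\<open>q ^ p\<close> is at least as close to 1 as \<open>q\<close>, so the
      induction hypothesis applies to it.\<close>
    have "absval (q ^ p - 1) ^ (p - 1) \<le> absval (q - 1) ^ (p - 1)"
      by (intro power_mono absval_power_diff_1_le q1 absval_nonneg)
    then have "absval ((q ^ p) ^ k' - 1) = absval (q ^ p - 1) * absval (of_nat k' :: 'a)"
      using less.prems by (intro less.IH \<open>k' < k\<close>) simp
    then show ?thesis
      using absval_power_p_diff_1[OF less.prems] 3 by (simp add: power_mult absval_mult)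
  qed simp
qed

section \<open>Density of the natural numbers in the p-adic integers\<close>

text \<open>In lowest terms the denominator is prime to \<open>p\<close>, hence invertible modulo
  every power of \<open>p\<close>; the fraction is then approximated by a residue modulo
  \<open>p ^ N\<close>.\<close>

lemma absval_of_rat_le_1_approx:
  assumes "t \<in> \<rat>" "absval (t :: 'a) \<le> 1" "e > 0"
  shows "\<exists>n. absval (t - of_nat n) < e"
proof -
  obtain r where t: "t = of_rat r" using assms(1) by (auto elim: Rats_cases)
  obtain a b where ab: "quotient_of r = (a, b)" by fastforce
  then have b: "b > 0" and cop: "coprime a b" and r: "r = of_int a / of_int b"
    by (auto simp: quotient_of_denom_pos quotient_of_coprime quotient_of_div)
  have t: "t = of_int a / of_int b" by (simp add: t r of_rat_divide)
  have p1: "p > 1" using prime_p prime_gt_1_nat by blast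
  have small: "absval (of_int c :: 'a) < 1 \<longleftrightarrow> int p dvd c" for c
  proof
    assume "int p dvd c"
    then obtain d where "c = int p * d" by blast
    then have "absval (of_int c :: 'a) = absval (of_int d :: 'a) / real p"
      by (simp add: absval_mult absval_p)
    also have "\<dots> \<le> 1 / real p" by (intro divide_right_mono absval_of_int_le_1) simp
    also have "\<dots> < 1" using p1 by simp
    finally show "absval (of_int c :: 'a) < 1" .
  next
    assume *: "absval (of_int c :: 'a) < 1"
    have "absval (of_int c :: 'a) = absval (of_nat (nat \<bar>c\<bar>) :: 'a)"
      by (cases "c \<ge> 0") auto
    with * show "int p dvd c"
      using absval_of_nat_coprime[of "nat \<bar>c\<bar>"] by (auto simp: dvd_nat_abs_iff)
  qed
  \<comment> \<open>Otherwise \<open>absval a \<le> absval b < 1\<close>, and \<open>p\<close> would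
    divide both numerator and denominator.\<close>
  have absb: "absval (of_int b :: 'a) = 1"
  proof (rule ccontr)
    assume "absval (of_int b :: 'a) \<noteq> 1"
    then have lt: "absval (of_int b :: 'a) < 1" using absval_of_int_le_1[of b] by (simp add: order_less_le)
    have "absval (of_int a :: 'a) \<le> absval (of_int b :: 'a)"
      using assms(2) b absval_nonneg[of "of_int b :: 'a"] absval_eq_0_iff[of "of_int b :: 'a"]
      by (simp add: t absval_divide divide_le_eq)
    with lt have "int p dvd a" "int p dvd b" by (simp_all flip: small)
    then have "int p dvd 1" using cop coprime_common_divisor by blast
    then show False using p1 by simp
  qed
  obtain N where N: "(1 / real p) ^ N < e"
    using real_arch_pow_inv[OF assms(3), of "1 / real p"] p1 by auto
  have "coprime b (int p ^ N)"
    using small[of b] absb prime_p prime_imp_coprime[of "int p" b]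
    by (simp add: coprime_commute[of b])
  then obtain c where c: "[b * c = 1] (mod int p ^ N)"
    using cong_solve_coprime_int by blast
  \<comment> \<open>\<open>c\<close> inverts \<open>b\<close> modulo \<open>p ^ N\<close>, so
    \<open>n\<close> is the natural representative of \<open>a / b\<close> there.\<close>
  define n where "n = nat ((a * c) mod int p ^ N)"
  have "int n = (a * c) mod int p ^ N"
    using p1 by (simp add: n_def)
  then have "[int n = a * c] (mod int p ^ N)" by (simp add: cong_def)
  then have "[b * int n = b * (a * c)] (mod int p ^ N)" by (rule cong_scalar_left)
  also have "b * (a * c) = a * (b * c)" by simp
  also have "[a * (b * c) = a * 1] (mod int p ^ N)" by (rule cong_scalar_left[OF c])
  finally have "int p ^ N dvd b * int n - a" by (simp add: cong_iff_dvd_diff)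
  then obtain d where "b * int n - a = int p ^ N * d" by blast
  then have "of_int (a - b * int n) = (of_int (- (int p ^ N * d)) :: 'a)" by (simp add: algebra_simps)
  then have d: "of_int a - of_int b * of_nat n = - (of_nat p ^ N * of_int d :: 'a)" by simp
  have "t - of_nat n = (of_int a - of_int b * of_nat n) / of_int b"
    using b by (simp add: t field_simps)
  then have "absval (t - of_nat n) = (1 / real p) ^ N * absval (of_int d :: 'a)"
    by (simp only: d absval_divide absb absval_minus absval_mult absval_power absval_p mult_1 div_by_1)
  also have "\<dots> \<le> (1 / real p) ^ N"
    by (intro mult_left_le absval_of_int_le_1) simp
  finally show ?thesis using N by (blast intro: le_less_trans)
qed

lemma padic_ints_limit_of_nat:
  assumes "z \<in> (padic_ints :: 'a set)"
  obtains m :: "nat \<Rightarrow> nat" where "(\<lambda>k. of_nat (m k)) \<longlonglongrightarrow> z"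
proof -
  have "z \<in> closure (range of_nat)"
    unfolding closure_approachable
  proof safe
    fix e :: real assume "e > 0"
    \<comment> \<open>A rational within distance 1 of \<open>z\<close> again has absolute value at
      most 1, as the approximation by natural numbers requires.\<close>
    then have "min e 1 > 0" by simp
    moreover have "z \<in> closure \<rat>" and z1: "absval z \<le> 1"
      using assms by (auto simp: padic_ints_def padic_rats_def)
    ultimately obtain t where t: "t \<in> \<rat>" "dist t z < min e 1"
      unfolding closure_approachable by meson
    then have "absval t \<le> 1"
      using absval_add_le_bound[of "t - z" 1 z] z1 by (simp add: dist_absval)
    then obtain n where "absval (t - of_nat n) < e"
      using absval_of_rat_le_1_approx t(1) \<open>e > 0\<close> by blast
    then have "dist (of_nat n) z < e"
      using absval_add_less_bound[of "of_nat n - t" e "t - z"] t(2) absval_minus_commute[of t "of_nat n"]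
      by (simp add: dist_absval)
    then show "\<exists>y\<in>range of_nat. dist y z < e" by blast
  qed
  then obtain f where f: "\<forall>k. f k \<in> range of_nat" "f \<longlonglongrightarrow> z"
    unfolding closure_sequential by blast
  then have "\<forall>k. \<exists>n. f k = of_nat n" by blast
  then obtain m where "\<forall>k. f k = of_nat (m k)" by (rule choice[THEN exE])
  then have "f = (\<lambda>k. of_nat (m k))" by (simp add: fun_eq_iff)
  with f(2) show ?thesis by (intro that) simp
qed

end

section \<open>The \<open>q\<close>-integral\<close>

locale padic_base = padic_field p "TYPE('a)" for p and q :: "'a::nonarch_field" +
  assumes q_ne_1: "q \<noteq> 1"
    and q_close_1: "absval (q - 1) ^ (p - 1) < 1 / real p"
begin

lemmas absval_q_power_diff_1 = absval_power_diff_1[OF q_close_1]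

text \<open>\<open>absval (q - 1) * absval k\<close> is nonzero in characteristic 0. This keeps all
  denominators \<open>1 - q ^ k\<close> away from 0.\<close>

lemma q_power_ne_1: "k > 0 \<Longrightarrow> q ^ k \<noteq> 1"
  using absval_q_power_diff_1[of k] q_ne_1
  by (metis absval_0 absval_eq_0_iff eq_iff_diff_eq_0 mult_eq_0_iff of_nat_eq_0_iff less_irrefl)

lemma absval_q: "absval q = 1"
  using absval_add_eq[of "q - 1" 1] absval_less_1[OF q_close_1] by simp

lemma absval_q_minus_1_le: "absval (q - 1) \<le> 1"
  using absval_add_le[of q "-1"] absval_q by simp

text \<open>The smaller power factors out with absolute value 1. As a Lipschitz bound for the p-adic
  distance of exponents, this lets \<open>q ^ n\<close> extend to p-adic limits.\<close>

lemma absval_q_power_diff_le: "absval (q ^ m - q ^ n) \<le> absval (of_nat m - of_nat n :: 'a)"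
proof (induction m n rule: linorder_wlog)
  case (le m n)
  have "q ^ m - q ^ n = - (q ^ m * (q ^ (n - m) - 1))"
    using le by (simp add: algebra_simps flip: power_add)
  then have "absval (q ^ m - q ^ n) = absval (q - 1) * absval (of_nat (n - m) :: 'a)"
    by (simp add: absval_mult absval_power absval_q absval_q_power_diff_1)
  also have "\<dots> \<le> absval (of_nat (n - m) :: 'a)"
    using absval_q_minus_1_le by (intro mult_left_le_one_le absval_nonneg)
  finally show ?case using le absval_minus_commute[of "of_nat n :: 'a" "of_nat m"] by (simp add: of_nat_diff)
qed (simp add: absval_minus_commute)

section \<open>Powers with p-adic exponents\<close>

text \<open>By the Lipschitz bound the powers form a Cauchy sequence, and its limit is also the
  limit along the whole filter in \<open>padic_pow\<close>, independent of the chosen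
  sequence.\<close>

lemma tendsto_padic_pow:
  assumes m: "(\<lambda>k. of_nat (m k)) \<longlonglongrightarrow> (z :: 'a)"
  shows "(\<lambda>k. q ^ m k) \<longlonglongrightarrow> padic_pow q z"
proof -
  have "Cauchy (\<lambda>k. of_nat (m k) :: 'a)" using m by (rule LIMSEQ_imp_Cauchy)
  then have "Cauchy (\<lambda>k. q ^ m k)"
    unfolding Cauchy_def dist_absval by (meson absval_q_power_diff_le le_less_trans)
  then obtain L where L: "(\<lambda>k. q ^ m k) \<longlonglongrightarrow> L"
    using complete_UNIV unfolding complete_def by auto
  let ?F = "filtercomap of_nat (nhds z)"
  \<comment> \<open>The sequence \<open>m\<close> witnesses that the filter is proper, so that
    limits along it are unique and \<open>Lim\<close> is determined.\<close>
  have m': "filterlim m ?F sequentially"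
    using m by (simp add: filterlim_filtercomap_iff o_def)
  then have "?F \<noteq> bot"
    by (auto simp: filterlim_def bot_unique filtermap_bot_iff)
  moreover have "((\<lambda>n. q ^ n) \<longlongrightarrow> L) ?F"
  proof (rule tendstoI)
    fix e :: real assume e: "e > 0"
    have "eventually (\<lambda>y. dist y z < e / 3) (nhds z)"
      using e unfolding eventually_nhds_metric by (intro exI[of _ "e / 3"]) simp
    then have "eventually (\<lambda>n. dist (of_nat n) z < e / 3) ?F"
      by (rule eventually_filtercomapI)
    then show "eventually (\<lambda>n. dist (q ^ n) L < e) ?F"
    proof eventually_elim
      case (elim n)
      have "eventually (\<lambda>k. dist (of_nat (m k)) z < e / 3) sequentially"
        "eventually (\<lambda>k. dist (q ^ m k) L < e / 3) sequentially"
        using e by (intro tendstoD[OF m] tendstoD[OF L]; simp)+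
      then have "eventually (\<lambda>k. dist (of_nat (m k)) z < e / 3 \<and> dist (q ^ m k) L < e / 3) sequentially"
        by (rule eventually_conj)
      \<comment> \<open>One index \<open>k\<close> with \<open>m k\<close> near \<open>z\<close> and
        \<open>q ^ m k\<close> near \<open>L\<close> links \<open>q ^ n\<close> to \<open>L\<close>;
        the three distances of \<open>e / 3\<close> add up to \<open>e\<close>.\<close>
      then obtain k where k: "dist (of_nat (m k)) z < e / 3" "dist (q ^ m k) L < e / 3"
        by (auto simp: eventually_sequentially)
      have "dist (q ^ n) (q ^ m k) \<le> dist (of_nat n :: 'a) (of_nat (m k))"
        by (simp add: dist_absval absval_q_power_diff_le)
      with k elim show ?case by metric
    qed
  qed
  ultimately have "padic_pow q z = L"
    unfolding padic_pow_def by (rule tendsto_Lim)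
  with L show ?thesis by simp
qed

lemma padic_pow_of_nat: "padic_pow q (of_nat n) = q ^ n"
  using tendsto_padic_pow[of "\<lambda>_. n" "of_nat n"] by (simp add: LIMSEQ_const_iff)

text \<open>The law for natural exponents passes to the limit along naturals tending to
  \<open>x\<close>. It splits the summation and integration variables off from
  \<open>x\<close>.\<close>

lemma padic_pow_of_nat_add:
  assumes "x \<in> padic_ints"
  shows "padic_pow q (of_nat a + of_nat b * x) = q ^ a * padic_pow q (of_nat b * x)"
proof -
  obtain m where m: "(\<lambda>k. of_nat (m k)) \<longlonglongrightarrow> x"
    using padic_ints_limit_of_nat[OF assms] .
  then have b: "(\<lambda>k. of_nat (b * m k)) \<longlonglongrightarrow> of_nat b * x"
    using tendsto_mult_left_nonarch by simp
  then have "(\<lambda>k. of_nat (a + b * m k)) \<longlonglongrightarrow> of_nat a + of_nat b * x"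
    unfolding of_nat_add by (intro tendsto_add tendsto_const)
  from tendsto_padic_pow[OF this]
  have "(\<lambda>k. q ^ a * q ^ (b * m k)) \<longlonglongrightarrow> padic_pow q (of_nat a + of_nat b * x)"
    by (simp add: power_add)
  moreover have "(\<lambda>k. q ^ a * q ^ (b * m k)) \<longlonglongrightarrow> q ^ a * padic_pow q (of_nat b * x)"
    by (intro tendsto_mult_left_nonarch tendsto_padic_pow b)
  ultimately show ?thesis by (rule LIMSEQ_unique)
qed

section \<open>Integrals of powers of q\<close>

lemma qbracket_of_nat: "qbracket q w (of_nat n) = (1 - q ^ (w * n)) / (1 - q ^ w)"
  using padic_pow_of_nat[of "w * n"] by (simp add: qbracket_def)

lemma tendsto_q_power_p_power: "(\<lambda>N. q ^ (k * p ^ N)) \<longlonglongrightarrow> 1"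
  unfolding tendsto_absval_iff
proof (rule tendsto_sandwich[of "\<lambda>_. 0" _ _ "\<lambda>N. (1 / real p) ^ N"])
  show "(\<lambda>N. (1 / real p) ^ N) \<longlonglongrightarrow> 0"
    using prime_gt_1_nat[OF prime_p] by (intro LIMSEQ_power_zero) simp
  have "absval (q ^ (k * p ^ N) - 1) \<le> (1 / real p) ^ N" for N
    using mult_mono[OF mult_mono[OF absval_q_minus_1_le absval_of_nat_le_1[of k, where ?'a='a]] order_refl,
        of "(1 / real p) ^ N"]
    by (simp add: absval_q_power_diff_1 absval_mult absval_power absval_p absval_nonneg mult.assoc)
  then show "\<forall>\<^sub>F N in sequentially. absval (q ^ (k * p ^ N) - 1) \<le> (1 / real p) ^ N" by simp
qed (auto simp: absval_nonneg)

text \<open>With \<open>Q = q ^ (w * p ^ N)\<close> the quotient is a constant times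
  \<open>(1 - Q ^ Suc i) / (1 - Q)\<close>, a sum of \<open>Suc i\<close> powers of \<open>Q\<close>
  that all tend to 1.\<close>

lemma tendsto_q_integral_power:
  assumes w: "w > 0"
  shows "(\<lambda>N. 1 / qbracket q w (of_nat (p ^ N)) * (\<Sum>y<p ^ N. q ^ (w * i * y) * q ^ (w * y)))
    \<longlonglongrightarrow> of_nat (Suc i) * (1 - q ^ w) / (1 - q ^ (w * Suc i))"
proof -
  let ?c = "(1 - q ^ w) / (1 - q ^ (w * Suc i))"
  have "1 / qbracket q w (of_nat (p ^ N)) * (\<Sum>y<p ^ N. q ^ (w * i * y) * q ^ (w * y))
      = ?c * (\<Sum>j<Suc i. q ^ (w * j * p ^ N))" for N
  proof -
    let ?Q = "q ^ (w * p ^ N)"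
    have pN: "p ^ N > 0" using prime_gt_0_nat[OF prime_p] by simp
    have "(\<Sum>y<p ^ N. q ^ (w * i * y) * q ^ (w * y)) = (\<Sum>y<p ^ N. (q ^ (w * Suc i)) ^ y)"
      by (intro sum.cong) (simp_all add: algebra_simps flip: power_add power_mult)
    also have "\<dots> = (1 - (q ^ (w * Suc i)) ^ (p ^ N)) / (1 - q ^ (w * Suc i))"
      using q_power_ne_1[of "w * Suc i"] w by (simp add: sum_gp_strict)
    also have "(q ^ (w * Suc i)) ^ (p ^ N) = ?Q ^ Suc i"
      by (simp only: mult_ac flip: power_mult)
    \<comment> \<open>The factor \<open>1 - ?Q\<close>, which tends to 0, cancels against the
      bracket of \<open>p ^ N\<close> before the limit is taken.\<close>
    also have "1 - ?Q ^ Suc i = (1 - ?Q) * (\<Sum>j<Suc i. ?Q ^ j)"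
      by (rule one_diff_power_eq)
    also have "(\<Sum>j<Suc i. ?Q ^ j) = (\<Sum>j<Suc i. q ^ (w * j * p ^ N))"
      by (simp only: mult_ac flip: power_mult)
    finally show ?thesis
      using q_power_ne_1[of "w * p ^ N"] q_power_ne_1[of w] w pN
      by (simp add: qbracket_of_nat del: sum.lessThan_Suc of_nat_power)
  qed
  moreover have "(\<lambda>N. ?c * (\<Sum>j<Suc i. q ^ (w * j * p ^ N))) \<longlonglongrightarrow> ?c * (\<Sum>j<Suc i. 1)"
    by (intro tendsto_mult_left_nonarch tendsto_sum tendsto_q_power_p_power)
  ultimately show ?thesis by (simp add: mult.commute)
qed

text \<open>The integral samples its integrand at natural numbers only, so \<open>f\<close> is
  prescribed just there; the rest is linearity.\<close>

lemma q_integral_power_sum: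
  assumes w: "w > 0" and f: "\<And>y. f (of_nat y) = (\<Sum>i\<in>I. c i * q ^ (w * i * y))"
  shows "q_integral p q w f = (\<Sum>i\<in>I. c i * (of_nat (Suc i) * (1 - q ^ w) / (1 - q ^ (w * Suc i))))"
proof -
  let ?b = "\<lambda>N. 1 / qbracket q w (of_nat (p ^ N))"
  have "?b N * (\<Sum>y<p ^ N. f (of_nat y) * q ^ (w * y))
      = (\<Sum>i\<in>I. c i * (?b N * (\<Sum>y<p ^ N. q ^ (w * i * y) * q ^ (w * y))))" for N
  proof -
    have "(\<Sum>y<p ^ N. f (of_nat y) * q ^ (w * y))
        = (\<Sum>y<p ^ N. \<Sum>i\<in>I. c i * (q ^ (w * i * y) * q ^ (w * y)))"
      by (simp add: f sum_distrib_right mult.assoc)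
    also have "\<dots> = (\<Sum>i\<in>I. \<Sum>y<p ^ N. c i * (q ^ (w * i * y) * q ^ (w * y)))"
      by (rule sum.swap)
    finally show ?thesis by (simp add: sum_distrib_left mult.left_commute)
  qed
  then show ?thesis
    unfolding q_integral_def
    by (simp only:) (intro limI tendsto_sum tendsto_mult_left_nonarch tendsto_q_integral_power w)
qed

text \<open>A power of \<open>q\<close> with the sum of the variables in its exponent is a product
  over the variables, and each integration contributes the same factor.\<close>

lemma q_integral_iter_power_sum:
  assumes w: "w > 0"
    and "\<And>ns. length ns = r \<Longrightarrow> f (map of_nat ns) = (\<Sum>i\<in>I. c i * q ^ (w * i * sum_list ns))"
  shows "q_integral_iter p q w r f
    = (\<Sum>i\<in>I. c i * (of_nat (Suc i) * (1 - q ^ w) / (1 - q ^ (w * Suc i))) ^ r)"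
  using assms(2)
proof (induction r arbitrary: f c)
  case 0
  then show ?case using "0.prems"[of "[]"] by simp
next
  case (Suc r)
  let ?A = "\<lambda>i. of_nat (Suc i) * (1 - q ^ w) / (1 - q ^ (w * Suc i))"
  have "q_integral_iter p q w r (\<lambda>ys. f (ys @ [of_nat y]))
      = (\<Sum>i\<in>I. (c i * q ^ (w * i * y)) * ?A i ^ r)" for y
  \<comment> \<open>For a fixed value \<open>y\<close> of the outermost variable, its power of
    \<open>q\<close> is absorbed into the coefficients.\<close>
  proof (rule Suc.IH)
    fix ns :: "nat list" assume "length ns = r"
    then have "f (map of_nat (ns @ [y])) = (\<Sum>i\<in>I. c i * q ^ (w * i * sum_list (ns @ [y])))"
      by (intro Suc.prems) simp
    also have "\<dots> = (\<Sum>i\<in>I. (c i * q ^ (w * i * y)) * q ^ (w * i * sum_list ns))"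
      by (intro sum.cong refl) (simp add: distrib_left power_add)
    finally show "f (map of_nat ns @ [of_nat y])
        = (\<Sum>i\<in>I. (c i * q ^ (w * i * y)) * q ^ (w * i * sum_list ns))"
      by simp
  qed
  then have "q_integral_iter p q w r (\<lambda>ys. f (ys @ [of_nat y]))
      = (\<Sum>i\<in>I. (c i * ?A i ^ r) * q ^ (w * i * y))" for y
    by (simp only: mult_ac)
  from q_integral_power_sum[OF w this] show ?case
    by (simp only: q_integral_iter.simps power_Suc2 mult.assoc)
qed

end

section \<open>Degenerate factorials and sums over multi-indices\<close>

text \<open>Each of the \<open>n\<close> factors takes one \<open>c\<close>. With the bracket of
  \<open>w1\<close> as \<open>c\<close>, this turns the parameter \<open>lam / c\<close> back into
  \<open>lam\<close>.\<close>

lemma degenerate_ffact_scale: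
  "c ^ n * degenerate_ffact a n \<mu> = degenerate_ffact (c * a) n (c * \<mu>)"
proof -
  have "c ^ n = (\<Prod>i<n. c)" by simp
  then show ?thesis
    by (simp only: degenerate_ffact_def right_diff_distrib mult.left_commute flip: prod.distrib)
qed

lemma degenerate_ffact_affine_poly:
  "\<exists>G. \<forall>t. degenerate_ffact (a + b * t) n \<mu> = poly G t"
  by (intro exI[of _ "\<Prod>i<n. [:a - of_nat i * \<mu>, b:]"])
    (simp add: degenerate_ffact_def poly_prod algebra_simps)

text \<open>The summand is a product over the coordinates of \<open>j\<close>, so the multiple sum
  factors by distributivity.\<close>

lemma sum_PiE_power_sum:
  fixes a :: "'a::comm_semiring_1"
  shows "(\<Sum>j \<in> {1..r} \<rightarrow>\<^sub>E {0..<w}. a ^ (\<Sum>l=1..r. j l)) = (\<Sum>k<w. a ^ k) ^ r"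
proof -
  have "(\<Sum>k<w. a ^ k) ^ r = (\<Prod>l\<in>{1..r}. \<Sum>k\<in>{0..<w}. a ^ k)"
    by (simp add: atLeast0LessThan)
  also have "\<dots> = (\<Sum>j \<in> {1..r} \<rightarrow>\<^sub>E {0..<w}. \<Prod>l\<in>{1..r}. a ^ j l)"
    by (rule prod_sum_PiE) auto
  finally show ?thesis by (simp add: power_sum)
qed

section \<open>Closed form of either side\<close>

context padic_base
begin

text \<open>\<open>G\<close> depends on neither \<open>w1\<close> nor \<open>w2\<close>, so the
  right-hand side is unchanged when these two are exchanged.\<close>

lemma degenerate_q_bernoulli_sum:
  assumes x: "x \<in> padic_ints" and w: "w1 > 0" "w2 > 0"
    and G: "\<And>t. degenerate_ffact (1 / (1 - q) + (- 1 / (1 - q)) * t) n lam = poly G t"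
  shows "qbracket q 1 (of_nat w1) powi (int n - int r) *
       (\<Sum>j \<in> {1..r} \<rightarrow>\<^sub>E {0..<w1}.
          q ^ (w2 * (\<Sum>l=1..r. j l)) *
          degenerate_q_bernoulli p r n (lam / qbracket q 1 (of_nat w1)) q w1
            (of_nat w2 * x + of_nat w2 / of_nat w1 * of_nat (\<Sum>l=1..r. j l)))
     = (\<Sum>i\<le>degree G. coeff G i * padic_pow q (of_nat (w1 * w2) * x) ^ i *
          (of_nat (Suc i) * (1 - q) * (1 - q ^ (w1 * w2 * Suc i))
             / ((1 - q ^ (w1 * Suc i)) * (1 - q ^ (w2 * Suc i)))) ^ r)"
proof -
  define B where "B = qbracket q 1 (of_nat w1)"
  define P where "P = padic_pow q (of_nat (w1 * w2) * x)"
  define A where "A = (\<lambda>i. of_nat (Suc i) * (1 - q ^ w1) / (1 - q ^ (w1 * Suc i)))"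
  let ?I = "{..degree G}"
  have ne: "1 - q ^ k \<noteq> 0" if "k > 0" for k
    using q_power_ne_1[OF that] by simp
  have ne1: "1 - q \<noteq> 0" using q_ne_1 by simp
  have B: "B = (1 - q ^ w1) / (1 - q)"
    by (simp add: B_def qbracket_of_nat)
  have B0: "B \<noteq> 0" using ne[of w1] ne1 w by (simp add: B)
  \<comment> \<open>Of the power \<open>n - r\<close> of \<open>B\<close>, the part
    \<open>B ^ n\<close> goes into the degenerate factorial; \<open>B ^ r\<close> stays as a
    divisor, one \<open>B\<close> for each integral.\<close>
  have bern: "B ^ n * degenerate_q_bernoulli p r n (lam / B) q w1
      (of_nat w2 * x + of_nat w2 / of_nat w1 * of_nat J)
    = (\<Sum>i\<in>?I. coeff G i * P ^ i * (q ^ (w2 * i)) ^ J * A i ^ r)" for J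
  proof -
    let ?c = "\<lambda>i. coeff G i * P ^ i * (q ^ (w2 * i)) ^ J / B ^ n"
    have "degenerate_q_bernoulli p r n (lam / B) q w1
        (of_nat w2 * x + of_nat w2 / of_nat w1 * of_nat J) = (\<Sum>i\<in>?I. ?c i * A i ^ r)"
      unfolding degenerate_q_bernoulli_def A_def
    proof (rule q_integral_iter_power_sum[OF w(1)])
      fix ns :: "nat list"
      let ?S = "sum_list ns"
      define z :: 'a where "z = sum_list (map of_nat ns) + (of_nat w2 * x + of_nat w2 / of_nat w1 * of_nat J)"
      have "sum_list (map of_nat ns) = (of_nat ?S :: 'a)"
        by (induction ns) simp_all
      \<comment> \<open>Multiplication by \<open>w1\<close> clears the denominator of
        \<open>w2 / w1\<close>, leaving a natural number plus a multiple of
        \<open>x\<close>.\<close>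
      then have "of_nat w1 * z = of_nat (w1 * ?S + w2 * J) + of_nat (w1 * w2) * x"
        using w by (simp add: z_def field_simps)
      then have pw: "padic_pow q (of_nat w1 * z) = q ^ (w1 * ?S + w2 * J) * P"
        using padic_pow_of_nat_add[OF x] unfolding P_def by metis
      have "B ^ n * degenerate_ffact (qbracket q w1 z) n (lam / B)
          = degenerate_ffact (B * qbracket q w1 z) n lam"
        using B0 by (simp add: degenerate_ffact_scale)
      \<comment> \<open>The denominator \<open>1 - q ^ w1\<close> of the bracket cancels, leaving
        the affine function of a power of \<open>q\<close> that \<open>G\<close> was made
        for.\<close>
      also have "B * qbracket q w1 z = (1 - q ^ (w1 * ?S + w2 * J) * P) / (1 - q)"
        using ne[of w1] w by (simp add: B qbracket_def pw)
      also have "\<dots> = 1 / (1 - q) + (- 1 / (1 - q)) * (q ^ (w1 * ?S + w2 * J) * P)"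
        by (simp add: diff_divide_distrib)
      also have "degenerate_ffact \<dots> n lam = (\<Sum>i\<in>?I. coeff G i * (q ^ (w1 * ?S + w2 * J) * P) ^ i)"
        by (simp only: G poly_altdef)
      also have "\<dots> = (\<Sum>i\<in>?I. coeff G i * P ^ i * (q ^ (w2 * i)) ^ J * q ^ (w1 * i * ?S))"
        by (intro sum.cong refl)
          (simp add: power_mult_distrib algebra_simps flip: power_mult power_add)
      finally have "degenerate_ffact (qbracket q w1 z) n (lam / B)
        = (\<Sum>i\<in>?I. coeff G i * P ^ i * (q ^ (w2 * i)) ^ J * q ^ (w1 * i * ?S)) / B ^ n"
        using B0 by (simp add: field_simps)
      then show "degenerate_ffact (qbracket q w1
          (sum_list (map of_nat ns) + (of_nat w2 * x + of_nat w2 / of_nat w1 * of_nat J))) n (lam / B)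
        = (\<Sum>i\<in>?I. ?c i * q ^ (w1 * i * ?S))"
        by (simp add: sum_divide_distrib z_def)
    qed
    then show ?thesis
      using B0 by (simp add: sum_distrib_left)
  qed
  \<comment> \<open>The weight \<open>q ^ (w2 * J)\<close> raises the exponent from \<open>i\<close>
    to \<open>Suc i\<close>, giving geometric sums in the coordinates of \<open>j\<close> with ratio
    \<open>q ^ (w2 * Suc i)\<close>.\<close>
  have summand: "q ^ (w2 * J) * (B ^ n * degenerate_q_bernoulli p r n (lam / B) q w1
      (of_nat w2 * x + of_nat w2 / of_nat w1 * of_nat J))
    = (\<Sum>i\<in>?I. coeff G i * P ^ i * A i ^ r * (q ^ (w2 * Suc i)) ^ J)" for J
  proof -
    have "(q ^ (w2 * Suc i)) ^ J = q ^ (w2 * J) * (q ^ (w2 * i)) ^ J" for i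
      by (simp add: algebra_simps flip: power_add power_mult)
    then show ?thesis
      unfolding bern sum_distrib_left by (simp only: mult_ac)
  qed
  have "B powi (int n - int r) *
       (\<Sum>j \<in> {1..r} \<rightarrow>\<^sub>E {0..<w1}.
          q ^ (w2 * (\<Sum>l=1..r. j l)) *
          degenerate_q_bernoulli p r n (lam / B) q w1
            (of_nat w2 * x + of_nat w2 / of_nat w1 * of_nat (\<Sum>l=1..r. j l)))
     = (\<Sum>j \<in> {1..r} \<rightarrow>\<^sub>E {0..<w1}. q ^ (w2 * (\<Sum>l=1..r. j l)) *
          (B ^ n * degenerate_q_bernoulli p r n (lam / B) q w1
            (of_nat w2 * x + of_nat w2 / of_nat w1 * of_nat (\<Sum>l=1..r. j l)))) / B ^ r"
    using B0 by (simp add: power_int_diff sum_distrib_left mult_ac flip: sum_divide_distrib)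
  also have "\<dots> = (\<Sum>j \<in> {1..r} \<rightarrow>\<^sub>E {0..<w1}. \<Sum>i\<in>?I.
      coeff G i * P ^ i * A i ^ r * (q ^ (w2 * Suc i)) ^ (\<Sum>l=1..r. j l)) / B ^ r"
    by (simp only: summand)
  also have "\<dots> = (\<Sum>i\<in>?I. \<Sum>j \<in> {1..r} \<rightarrow>\<^sub>E {0..<w1}.
      coeff G i * P ^ i * A i ^ r * (q ^ (w2 * Suc i)) ^ (\<Sum>l=1..r. j l)) / B ^ r"
    by (subst sum.swap) (rule refl)
  also have "\<dots> = (\<Sum>i\<in>?I. coeff G i * P ^ i * (A i * (\<Sum>k<w1. (q ^ (w2 * Suc i)) ^ k) / B) ^ r)"
    by (simp only: sum_PiE_power_sum sum_divide_distrib power_mult_distrib power_divide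
        mult.assoc times_divide_eq_right flip: sum_distrib_left)
  also have "\<dots> = (\<Sum>i\<in>?I. coeff G i * P ^ i *
      (of_nat (Suc i) * (1 - q) * (1 - q ^ (w1 * w2 * Suc i))
        / ((1 - q ^ (w1 * Suc i)) * (1 - q ^ (w2 * Suc i)))) ^ r)"
  proof (intro sum.cong refl arg_cong2[of _ _ _ _ "(*)"] arg_cong[of _ _ "\<lambda>t. t ^ r"])
    fix i
    have "(\<Sum>k<w1. (q ^ (w2 * Suc i)) ^ k) = (1 - (q ^ (w2 * Suc i)) ^ w1) / (1 - q ^ (w2 * Suc i))"
      using q_power_ne_1[of "w2 * Suc i"] w by (simp add: sum_gp_strict)
    also have "(q ^ (w2 * Suc i)) ^ w1 = q ^ (w1 * w2 * Suc i)"
      by (simp only: mult_ac flip: power_mult)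
    \<comment> \<open>The factor \<open>1 - q ^ w1\<close> in \<open>A i\<close> cancels against the
      one in \<open>B\<close>; this removes the last asymmetry.\<close>
    finally show "A i * (\<Sum>k<w1. (q ^ (w2 * Suc i)) ^ k) / B =
        of_nat (Suc i) * (1 - q) * (1 - q ^ (w1 * w2 * Suc i))
        / ((1 - q ^ (w1 * Suc i)) * (1 - q ^ (w2 * Suc i)))"
      using ne[OF w(1)] by (simp add: A_def B)
  qed
  finally show ?thesis unfolding B_def P_def .
qed

end

theorem theorem2:
  fixes p r n w1 w2 :: nat and q lam x :: "'a::nonarch_field"
  assumes "is_padic_complex p TYPE('a)"
    and "prime p" and "odd p"
    and "q \<noteq> 1" and "absval (1 - q) < real p powr (- 1 / (real p - 1))"
    and "x \<in> padic_ints"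
    and "r \<ge> 1" and "w1 \<ge> 1" and "w2 \<ge> 1"
  shows
    "qbracket q 1 (of_nat w1) powi (int n - int r) *
       (\<Sum>j \<in> {1..r} \<rightarrow>\<^sub>E {0..<w1}.
          q ^ (w2 * (\<Sum>l=1..r. j l)) *
          degenerate_q_bernoulli p r n (lam / qbracket q 1 (of_nat w1)) q w1
            (of_nat w2 * x + of_nat w2 / of_nat w1 * of_nat (\<Sum>l=1..r. j l)))
     = qbracket q 1 (of_nat w2) powi (int n - int r) *
       (\<Sum>j \<in> {1..r} \<rightarrow>\<^sub>E {0..<w2}.
          q ^ (w1 * (\<Sum>l=1..r. j l)) *
          degenerate_q_bernoulli p r n (lam / qbracket q 1 (of_nat w2)) q w2
            (of_nat w1 * x + of_nat w1 / of_nat w2 * of_nat (\<Sum>l=1..r. j l)))"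
proof -
  have p1: "p > 1" using \<open>prime p\<close> by (rule prime_gt_1_nat)
  have "absval (q - 1) ^ (p - 1) < (real p powr (- 1 / (real p - 1))) ^ (p - 1)"
    using assms(5) p1 by (intro power_strict_mono) (simp_all add: absval_minus_commute absval_nonneg)
  also have "\<dots> = 1 / real p"
    using p1 by (simp add: powr_power of_nat_diff powr_minus divide_simps)
  finally interpret padic_base p q
    using assms(1-4) by unfold_locales (simp_all add: is_padic_complex_def)
  \<comment> \<open>A single polynomial serves both sides, since it is built from \<open>q\<close>,
    \<open>n\<close> and \<open>lam\<close> alone.\<close>
  obtain G where "\<And>t. degenerate_ffact (1 / (1 - q) + (- 1 / (1 - q)) * t) n lam = poly G t"
    using degenerate_ffact_affine_poly by metis
  note eq = degenerate_q_bernoulli_sum[OF \<open>x \<in> padic_ints\<close> _ _ this]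
  show ?thesis
    using eq[of w1 w2 r] eq[of w2 w1 r] assms(8,9) by (simp add: mult_ac)
qed

end
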